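(* Let $\mathrm{M}$ be an o-minimal structure expanding $(\mathbb{R},<,+,\cdot)$, let $\mathcal{S}=(S_b,S_a,I,O,\alpha)$ be a system over $\mathrm{Def}(\mathrm{M})$, and let $j=(j_I:I\to I',\,j_O:O\to O')$ be a judge for $\mathcal{S}$. Then the behavioral presheaf $\mathcal{F}_j^{\mathrm{beh}}$ satisfies the separation axiom with respect to the coverings: for every definable open immersion $m:\mathcal{S}_U\hookrightarrow\mathcal{S}$ and every covering $\{m_\alpha:\mathcal{S}_\alpha\hookrightarrow\mathcal{S}_U\}$, two elements of $\mathcal{F}_j^{\mathrm{beh}}(\mathcal{S}_U)$ having the same restriction in $\mathcal{F}_j^{\mathrm{beh}}(\mathcal{S}_\alpha)$ for every $\alpha$ are equal.
   Context: $\mathrm{M}$ is an o-minimal structure expanding the real field: Boolean algebras $\mathcal{D}_n$ of subsets of $\mathbb{R}^n$ ($n\ge1$), closed under products and projections, with $\mathcal{D}_n$ containing the semialgebraic sets and $\mathcal{D}_1$ consisting exactly of finite unions of intervals and points. Elements of $\mathcal{D}_n$ are definable sets; a function is definable if its graph is. $\mathrm{Def}(\mathrm{M})$ is the category of definable sets and definable maps. A definable open immersion $U\hookrightarrow X$ is a definable injection with definable open image, regarded as the inclusion of an open subset with the subspace topology. A system is $\mathcal{S}=(S_b,S_a,I,O,\alpha)$ with definable sets $S_b,S_a,I,O$ and a definable map $\alpha:S_b\times I\to S_a\times O$; all systems have non-empty $I$ and $O$. A morphism is a 4-tuple of definable maps $(f_b,f_a,f_I,f_O)$ with $(f_a\times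 f_O)\circ\alpha=\alpha'\circ(f_b\times f_I)$. It is a definable open immersion if each component is. A finite family $\{m_\alpha:\mathcal{S}_\alpha\hookrightarrow\mathcal{S}\}$ of definable open immersions is a covering if $\bigsqcup_\alpha(S_{\alpha,b}\times I_\alpha)\to S_b\times I$ and $\bigsqcup_\alpha(S_{\alpha,a}\times O_\alpha)\to S_a\times O$ are surjective. A system is homogeneous if its before-states and after-states coincide. A judge for $\mathcal{S}$ is a pair of definable maps $j_I:I\to I'$, $j_O:O\to O'$. For a definable open immersion $m:\mathcal{S}_U\hookrightarrow\mathcal{S}$, $\tilde{\mathcal{F}}_j(\mathcal{S}_U)$ is the set of pairs $(\mathcal{S}',\psi)$ where $\mathcal{S}'=(S',S',I',O',\alpha')$ is a homogeneous system with interface $(I',O')$ and $\psi:\mathcal{S}_U\to\mathcal{S}'$ is a morphism of systems with $\psi_I=j_I\circ m_I$ and $\psi_O=j_O\circ m_O$ (the components $\psi_b,\psi_a:S_{U,b},S_{U,a}\to S'$ may be different). Restriction along $n:\mathcal{S}_{U'}\hookrightarrow\mathcal{S}_U$ is $(\mathcal{S}',\psi)\mapsto(\mathcal{S}',\psi\circ n)$. Two pairs $(\mathcal{S}_1',\psi_1),(\mathcal{S}_2',\psi_2)\in\tilde{\mathcal{F}}_j(\mathcal{S}_U)$ are behaviorally equivalent, written $\approx$, if for every $x\in S_{U,b}$, every $n$ and every $(i_1',\dots,i_n')\in(I')^n$, the output sequences produced by running $\mathcal{S}_1'$ from $\psi_{1,b}(x)$ and $\mathcal{S}_2'$ from $\psi_{2,b}(x)$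 on inputs $i_1',\dots,i_n'$ coincide. The behavioral presheaf is $\mathcal{F}_j^{\mathrm{beh}}:=\tilde{\mathcal{F}}_j/{\approx}$. *)

theory Defs
  imports "HOL-Analysis.Analysis"
begin

text \<open>Points of \<open>\<real>\<^sup>n\<close> are real lists of length \<open>n\<close>, so that
  \<open>\<real>\<^sup>m \<times> \<real>\<^sup>n = \<real>\<^sup>m\<^sup>+\<^sup>n\<close> is concatenation of lists.\<close>

definition Rn :: "nat \<Rightarrow> real list set" where
  "Rn n = {x. length x = n}"

definition Rn_topology :: "nat \<Rightarrow> real list topology" where
  "Rn_topology n =
     pullback_topology (Rn n) (\<lambda>x. restrict ((!) x) {..<n}) (powertop_real {..<n})"

inductive polyfun :: "nat \<Rightarrow> (real list \<Rightarrow> real) \<Rightarrow> bool" for n where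
  const: "polyfun n (\<lambda>x. c)"
| coord: "i < n \<Longrightarrow> polyfun n (\<lambda>x. x ! i)"
| add: "polyfun n p \<Longrightarrow> polyfun n q \<Longrightarrow> polyfun n (\<lambda>x. p x + q x)"
| mult: "polyfun n p \<Longrightarrow> polyfun n q \<Longrightarrow> polyfun n (\<lambda>x. p x * q x)"

inductive_set semialgebraic :: "nat \<Rightarrow> real list set set" for n where
  zero: "polyfun n p \<Longrightarrow> {x \<in> Rn n. p x = 0} \<in> semialgebraic n"
| pos: "polyfun n p \<Longrightarrow> {x \<in> Rn n. p x > 0} \<in> semialgebraic n"
| compl: "X \<in> semialgebraic n \<Longrightarrow> Rn n - X \<in> semialgebraic n"
| union: "X \<in> semialgebraic n \<Longrightarrow> Y \<in> semialgebraic n \<Longrightarrow> X \<union> Y \<in> semialgebraic n"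

definition set_append :: "real list set \<Rightarrow> real list set \<Rightarrow> real list set" where
  "set_append X Y = {x @ y | x y. x \<in> X \<and> y \<in> Y}"

text \<open>\<open>is_interval\<close> means order-convex: it covers all open, closed, half-open, bounded and
  unbounded intervals as well as single points. The value \<open>D 0\<close> is irrelevant.\<close>

definition o_minimal :: "(nat \<Rightarrow> real list set set) \<Rightarrow> bool" where
  "o_minimal D \<longleftrightarrow>
     (\<forall>n\<ge>1. D n \<subseteq> Pow (Rn n) \<and> {} \<in> D n \<and>
        (\<forall>X\<in>D n. Rn n - X \<in> D n) \<and> (\<forall>X\<in>D n. \<forall>Y\<in>D n. X \<union> Y \<in> D n)) \<and>
     (\<forall>m\<ge>1. \<forall>n\<ge>1. \<forall>X\<in>D m. \<forall>Y\<in>D n. set_append X Y \<in> D (m + n)) \<and>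
     (\<forall>n\<ge>1. \<forall>X\<in>D (Suc n). butlast ` X \<in> D n) \<and>
     (\<forall>n\<ge>1. semialgebraic n \<subseteq> D n) \<and>
     D 1 = {(\<lambda>t. [t]) ` \<Union>F | F. finite F \<and> (\<forall>J\<in>F. is_interval J)}"

record dset =
  arity :: nat
  pts :: "real list set"

definition definable :: "(nat \<Rightarrow> real list set set) \<Rightarrow> dset \<Rightarrow> bool" where
  "definable D A \<longleftrightarrow> arity A \<ge> 1 \<and> pts A \<in> D (arity A)"

text \<open>Maps are extensional (\<open>undefined\<close> off their domain), so that equality of maps is equality
  in HOL.\<close>

definition definable_map ::
  "(nat \<Rightarrow> real list set set) \<Rightarrow> dset \<Rightarrow> dset \<Rightarrow> (real list \<Rightarrow> real list) \<Rightarrow> bool" where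
  "definable_map D A B f \<longleftrightarrow>
     f \<in> pts A \<rightarrow>\<^sub>E pts B \<and> {x @ f x | x. x \<in> pts A} \<in> D (arity A + arity B)"

text \<open>Openness refers to the subspace topology of \<open>B\<close>. As the maps of \<open>Def(M)\<close> need not be
  continuous, neither need \<open>f\<close> be: \<open>A\<close> is identified with \<open>f ` A\<close> as a definable set, and
  embeddings that are homeomorphisms onto their image are a special case.\<close>

definition open_immersion ::
  "(nat \<Rightarrow> real list set set) \<Rightarrow> dset \<Rightarrow> dset \<Rightarrow> (real list \<Rightarrow> real list) \<Rightarrow> bool" where
  "open_immersion D A B f \<longleftrightarrow>
     definable_map D A B f \<and> inj_on f (pts A) \<and>
     f ` pts A \<in> D (arity B) \<and>
     openin (subtopology (Rn_topology (arity B)) (pts B)) (f ` pts A)"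

record system =
  bef :: dset
  aft :: dset
  inp :: dset
  outp :: dset
  step :: "real list \<times> real list \<Rightarrow> real list \<times> real list"

definition is_system :: "(nat \<Rightarrow> real list set set) \<Rightarrow> system \<Rightarrow> bool" where
  "is_system D S \<longleftrightarrow>
     definable D (bef S) \<and> definable D (aft S) \<and> definable D (inp S) \<and> definable D (outp S) \<and>
     pts (inp S) \<noteq> {} \<and> pts (outp S) \<noteq> {} \<and>
     step S \<in> pts (bef S) \<times> pts (inp S) \<rightarrow>\<^sub>E pts (aft S) \<times> pts (outp S) \<and>
     {s @ i @ fst (step S (s, i)) @ snd (step S (s, i)) | s i. s \<in> pts (bef S) \<and> i \<in> pts (inp S)}
       \<in> D (arity (bef S) + arity (inp S) + arity (aft S) + arity (outp S))"

definition homogeneous :: "system \<Rightarrow> bool" where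
  "homogeneous S \<longleftrightarrow> bef S = aft S"

record morphism =
  mb :: "real list \<Rightarrow> real list"
  ma :: "real list \<Rightarrow> real list"
  mi :: "real list \<Rightarrow> real list"
  mo :: "real list \<Rightarrow> real list"

definition is_morphism ::
  "(nat \<Rightarrow> real list set set) \<Rightarrow> system \<Rightarrow> system \<Rightarrow> morphism \<Rightarrow> bool" where
  "is_morphism D S T f \<longleftrightarrow>
     definable_map D (bef S) (bef T) (mb f) \<and> definable_map D (aft S) (aft T) (ma f) \<and>
     definable_map D (inp S) (inp T) (mi f) \<and> definable_map D (outp S) (outp T) (mo f) \<and>
     (\<forall>s\<in>pts (bef S). \<forall>i\<in>pts (inp S).
        map_prod (ma f) (mo f) (step S (s, i)) = step T (mb f s, mi f i))"

text \<open>The composite \<open>g \<circ> f\<close> for \<open>f\<close> with domain \<open>S\<close>.\<close>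

definition mor_comp :: "system \<Rightarrow> morphism \<Rightarrow> morphism \<Rightarrow> morphism" where
  "mor_comp S g f =
     \<lparr>mb = compose (pts (bef S)) (mb g) (mb f), ma = compose (pts (aft S)) (ma g) (ma f),
      mi = compose (pts (inp S)) (mi g) (mi f), mo = compose (pts (outp S)) (mo g) (mo f)\<rparr>"

definition sys_open_immersion ::
  "(nat \<Rightarrow> real list set set) \<Rightarrow> system \<Rightarrow> system \<Rightarrow> morphism \<Rightarrow> bool" where
  "sys_open_immersion D S T m \<longleftrightarrow>
     is_morphism D S T m \<and>
     open_immersion D (bef S) (bef T) (mb m) \<and> open_immersion D (aft S) (aft T) (ma m) \<and>
     open_immersion D (inp S) (inp T) (mi m) \<and> open_immersion D (outp S) (outp T) (mo m)"

definition covering ::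
  "(nat \<Rightarrow> real list set set) \<Rightarrow> system \<Rightarrow> 'k set \<Rightarrow> ('k \<Rightarrow> system) \<Rightarrow> ('k \<Rightarrow> morphism) \<Rightarrow> bool" where
  "covering D S K V c \<longleftrightarrow>
     finite K \<and> (\<forall>k\<in>K. is_system D (V k) \<and> sys_open_immersion D (V k) S (c k)) \<and>
     (\<Union>k\<in>K. map_prod (mb (c k)) (mi (c k)) ` (pts (bef (V k)) \<times> pts (inp (V k))))
       = pts (bef S) \<times> pts (inp S) \<and>
     (\<Union>k\<in>K. map_prod (ma (c k)) (mo (c k)) ` (pts (aft (V k)) \<times> pts (outp (V k))))
       = pts (aft S) \<times> pts (outp S)"

text \<open>\<open>jin\<close> and \<open>jout\<close> are the codomains \<open>I'\<close> and \<open>O'\<close> of the maps \<open>jI\<close> and \<open>jO\<close>.\<close>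

record judge =
  jin :: dset
  jout :: dset
  jI :: "real list \<Rightarrow> real list"
  jO :: "real list \<Rightarrow> real list"

definition is_judge :: "(nat \<Rightarrow> real list set set) \<Rightarrow> system \<Rightarrow> judge \<Rightarrow> bool" where
  "is_judge D S j \<longleftrightarrow>
     definable D (jin j) \<and> definable D (jout j) \<and>
     definable_map D (inp S) (jin j) (jI j) \<and> definable_map D (outp S) (jout j) (jO j)"

definition sections ::
  "(nat \<Rightarrow> real list set set) \<Rightarrow> judge \<Rightarrow> system \<Rightarrow> morphism \<Rightarrow> (system \<times> morphism) set" where
  "sections D j U m = {(T, \<psi>).
     is_system D T \<and> homogeneous T \<and> inp T = jin j \<and> outp T = jout j \<and>
     is_morphism D U T \<psi> \<and>
     mi \<psi> = compose (pts (inp U)) (jI j) (mi m) \<and>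
     mo \<psi> = compose (pts (outp U)) (jO j) (mo m)}"

definition sec_restrict :: "system \<Rightarrow> morphism \<Rightarrow> system \<times> morphism \<Rightarrow> system \<times> morphism" where
  "sec_restrict V n = (\<lambda>(T, \<psi>). (T, mor_comp V \<psi> n))"

fun run :: "system \<Rightarrow> real list \<Rightarrow> real list list \<Rightarrow> real list list" where
  "run T s [] = []"
| "run T s (i # is) = snd (step T (s, i)) # run T (fst (step T (s, i))) is"

definition beh_equiv ::
  "(nat \<Rightarrow> real list set set) \<Rightarrow> judge \<Rightarrow> system \<Rightarrow> morphism \<Rightarrow> (system \<times> morphism) rel" where
  "beh_equiv D j U m = {((T1, \<psi>1), (T2, \<psi>2)).
     (T1, \<psi>1) \<in> sections D j U m \<and> (T2, \<psi>2) \<in> sections D j U m \<and>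
     (\<forall>x\<in>pts (bef U). \<forall>is\<in>lists (pts (jin j)). run T1 (mb \<psi>1 x) is = run T2 (mb \<psi>2 x) is)}"

lemma equiv_beh_equiv: "equiv (sections D j U m) (beh_equiv D j U m)"
  by (rule equivI) (auto simp: beh_equiv_def refl_on_def sym_def trans_def)

definition beh_presheaf ::
  "(nat \<Rightarrow> real list set set) \<Rightarrow> judge \<Rightarrow> system \<Rightarrow> morphism \<Rightarrow> (system \<times> morphism) set set" where
  "beh_presheaf D j U m = sections D j U m // beh_equiv D j U m"

text \<open>Restriction of a class along \<open>n : V \<rightarrow> U\<close>, where \<open>U\<close> lies over the ambient system by \<open>m\<close>:
  the class of the restriction of any representative.\<close>

definition beh_restrict ::
  "(nat \<Rightarrow> real list set set) \<Rightarrow> judge \<Rightarrow> morphism \<Rightarrow> system \<Rightarrow> morphism \<Rightarrow>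
     (system \<times> morphism) set \<Rightarrow> (system \<times> morphism) set" where
  "beh_restrict D j m V n C = beh_equiv D j V (mor_comp V m n) `` (sec_restrict V n ` C)"

end

theory Submission imports Defs begin

text \<open>Behavioural equivalence of two sections over \<open>U\<close> is a condition on each before-state \<open>x\<close> of
  \<open>U\<close> separately: the two runs started at the images of \<open>x\<close> must agree. The image of \<open>x\<close> depends
  only on \<open>x\<close>, so if \<open>x\<close> is the image of a before-state \<open>y\<close> of some member of a covering, then the
  condition at \<open>x\<close> for two sections is literally the condition at \<open>y\<close> for their restrictions. A
  covering reaches every pair of a before-state and an input; as \<open>U\<close> has at least one input, it
  reaches every before-state, and separation follows (\<open>beh_equiv_if_locally\<close>).

  The real work is to see that restriction is well defined, i.e. that it sends sections to sections
  (\<open>sec_restrict_in_sections\<close>). Classes of a non-section would be empty, and equality of restrictions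
  would then carry no information. This amounts to the closure of definable maps under composition
  (\<open>definable_map_compose\<close>), where o-minimality enters through the Boolean operations, products,
  projections and semialgebraic sets. The graph of \<open>g \<circ> f\<close> is the projection along \<open>y\<close> of the set
  of \<open>(x, z, y)\<close> with \<open>(x, y)\<close> in the graph of \<open>f\<close> and \<open>(y, z)\<close> in the graph of \<open>g\<close>. Each of the two
  conditions reads off some coordinates in a prescribed order, and preimages under such coordinate
  maps are definable (\<open>o_minimal_coordinate_preimage\<close>).\<close>

section \<open>Definable sets and coordinate maps\<close>

lemma o_minimal_closure:
  assumes "o_minimal D"
  shows "\<forall>n\<ge>1. D n \<subseteq> Pow (Rn n) \<and> {} \<in> D n \<and>
      (\<forall>X\<in>D n. Rn n - X \<in> D n) \<and> (\<forall>X\<in>D n. \<forall>Y\<in>D n. X \<union> Y \<in> D n)"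
    and "\<forall>m\<ge>1. \<forall>n\<ge>1. \<forall>X\<in>D m. \<forall>Y\<in>D n. set_append X Y \<in> D (m + n)"
    and "\<forall>n\<ge>1. \<forall>X\<in>D (Suc n). butlast ` X \<in> D n"
    and "\<forall>n\<ge>1. semialgebraic n \<subseteq> D n"
  using assms unfolding o_minimal_def by - (elim conjE, assumption)+

lemma o_minimal_subset: "o_minimal D \<Longrightarrow> n \<ge> 1 \<Longrightarrow> X \<in> D n \<Longrightarrow> X \<subseteq> Rn n"
  using o_minimal_closure(1) by blast

lemma o_minimal_empty: "o_minimal D \<Longrightarrow> n \<ge> 1 \<Longrightarrow> {} \<in> D n"
  using o_minimal_closure(1) by blast

lemma o_minimal_compl: "o_minimal D \<Longrightarrow> n \<ge> 1 \<Longrightarrow> X \<in> D n \<Longrightarrow> Rn n - X \<in> D n"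
  using o_minimal_closure(1) by blast

lemma o_minimal_Un: "o_minimal D \<Longrightarrow> n \<ge> 1 \<Longrightarrow> X \<in> D n \<Longrightarrow> Y \<in> D n \<Longrightarrow> X \<union> Y \<in> D n"
  using o_minimal_closure(1) by blast

lemma o_minimal_set_append:
  "o_minimal D \<Longrightarrow> m \<ge> 1 \<Longrightarrow> n \<ge> 1 \<Longrightarrow> X \<in> D m \<Longrightarrow> Y \<in> D n \<Longrightarrow> set_append X Y \<in> D (m + n)"
  using o_minimal_closure(2) by blast

lemma o_minimal_butlast: "o_minimal D \<Longrightarrow> n \<ge> 1 \<Longrightarrow> X \<in> D (Suc n) \<Longrightarrow> butlast ` X \<in> D n"
  using o_minimal_closure(3) by blast

lemma o_minimal_semialgebraic: "o_minimal D \<Longrightarrow> n \<ge> 1 \<Longrightarrow> X \<in> semialgebraic n \<Longrightarrow> X \<in> D n"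
  using o_minimal_closure(4) by blast

lemma o_minimal_Int:
  assumes "o_minimal D" "n \<ge> 1" "X \<in> D n" "Y \<in> D n"
  shows "X \<inter> Y \<in> D n"
proof -
  have "X \<inter> Y = Rn n - ((Rn n - X) \<union> (Rn n - Y))"
    using o_minimal_subset[OF assms(1,2)] assms(3,4) by blast
  then show ?thesis
    using assms by (simp add: o_minimal_compl o_minimal_Un)
qed

lemma o_minimal_Rn:
  assumes "o_minimal D" "n \<ge> 1"
  shows "Rn n \<in> D n"
  using o_minimal_compl[OF assms o_minimal_empty[OF assms]] by simp

lemma o_minimal_take:
  assumes "o_minimal D" "n \<ge> 1" "X \<in> D (n + k)"
  shows "take n ` X \<in> D n"
  using assms(3)
proof (induction k arbitrary: X)
  case 0
  then have "X \<subseteq> Rn n"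
    using o_minimal_subset[OF assms(1,2)] by simp
  then have "take n ` X = X"
    by (force simp: Rn_def image_iff)
  with 0 show ?case by simp
next
  case (Suc k)
  have X: "X \<subseteq> Rn (Suc (n + k))"
    using o_minimal_subset[OF assms(1), of "n + Suc k" X] Suc.prems by simp
  have "butlast ` X \<in> D (n + k)"
    using o_minimal_butlast[OF assms(1), of "n + k" X] Suc.prems assms(2) by simp
  then have "take n ` butlast ` X \<in> D n"
    by (rule Suc.IH)
  moreover have "take n ` butlast ` X = take n ` X"
    unfolding image_image using X by (intro image_cong refl) (auto simp: Rn_def take_butlast)
  ultimately show ?case by simp
qed

lemma o_minimal_coordinates_equal:
  assumes "o_minimal D" "i < n" "j < n"
  shows "{w \<in> Rn n. w ! i = w ! j} \<in> D n"
proof -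
  have "polyfun n (\<lambda>w. w ! i + (- 1) * w ! j)"
    by (intro polyfun.intros assms)
  from semialgebraic.zero[OF this] have "{w \<in> Rn n. w ! i = w ! j} \<in> semialgebraic n"
    by simp
  then show ?thesis
    using assms by (auto intro: o_minimal_semialgebraic[OF assms(1)])
qed

lemma o_minimal_many_coordinates_equal:
  assumes "o_minimal D" "n \<ge> 1" "finite E" "\<And>i j. (i, j) \<in> E \<Longrightarrow> i < n \<and> j < n"
  shows "{w \<in> Rn n. \<forall>(i, j)\<in>E. w ! i = w ! j} \<in> D n"
  using assms(3,4)
proof (induction E rule: finite_induct)
  case empty
  then show ?case using o_minimal_Rn[OF assms(1,2)] by simp
next
  case (insert e E)
  obtain i j where e: "e = (i, j)" by (cases e)
  have "{w \<in> Rn n. \<forall>(i, j)\<in>insert e E. w ! i = w ! j}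
      = {w \<in> Rn n. w ! i = w ! j} \<inter> {w \<in> Rn n. \<forall>(i, j)\<in>E. w ! i = w ! j}"
    using e by auto
  moreover have "{w \<in> Rn n. w ! i = w ! j} \<in> D n"
    using insert.prems e by (intro o_minimal_coordinates_equal assms(1)) auto
  moreover have "{w \<in> Rn n. \<forall>(i, j)\<in>E. w ! i = w ! j} \<in> D n"
    using insert.prems by (intro insert.IH) auto
  ultimately show ?case
    using o_minimal_Int[OF assms(1,2)] by simp
qed

text \<open>The preimage is the projection to \<open>\<real>\<^sup>m\<close> of the part of \<open>\<real>\<^sup>m \<times> X\<close> on which the point of \<open>X\<close> is the
  prescribed list of coordinates of the point of \<open>\<real>\<^sup>m\<close>; this part is cut out by equations between
  coordinates. Permuting, repeating and omitting coordinates are all instances, which makes up for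
  the fact that the axioms only speak of dropping the last coordinate.\<close>

lemma o_minimal_coordinate_preimage:
  assumes D: "o_minimal D" and m: "m \<ge> 1" and "is \<noteq> []" and "set is \<subseteq> {..<m}"
    and X: "X \<in> D (length is)"
  shows "{w \<in> Rn m. map ((!) w) is \<in> X} \<in> D m"
proof -
  define n where "n = length is"
  define E where "E = (\<lambda>k. (m + k, is ! k)) ` {..<n}"
  define G where "G = set_append (Rn m) X \<inter> {w \<in> Rn (m + n). \<forall>(i, j)\<in>E. w ! i = w ! j}"
  have n: "n \<ge> 1" and X': "X \<in> D n"
    using assms by (auto simp: n_def Suc_le_eq)
  have lt: "is ! k < m" if "k < n" for k
    using that assms(4) nth_mem[of k "is"] unfolding n_def by blast
  have XR: "X \<subseteq> Rn n"
    using o_minimal_subset[OF D n X'] .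
  have "G \<in> D (m + n)"
    unfolding G_def
  proof (rule o_minimal_Int[OF D])
    show "set_append (Rn m) X \<in> D (m + n)"
      by (intro o_minimal_set_append D m n o_minimal_Rn X')
    show "{w \<in> Rn (m + n). \<forall>(i, j)\<in>E. w ! i = w ! j} \<in> D (m + n)"
      using m lt by (intro o_minimal_many_coordinates_equal D) (auto simp: E_def intro: trans_less_add1)
  qed (use m in simp)
  moreover have "take m ` G = {w \<in> Rn m. map ((!) w) is \<in> X}"
  proof (intro equalityI subsetI)
    fix v assume "v \<in> take m ` G"
    then obtain w where w: "w \<in> G" and v: "v = take m w" by blast
    from w obtain u x where u: "u \<in> Rn m" and x: "x \<in> X" and wux: "w = u @ x"
      unfolding G_def set_append_def by blast
    have len: "length u = m" "length x = n"
      using u x XR by (auto simp: Rn_def)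
    have "map ((!) u) is = x"
    proof (rule nth_equalityI)
      fix k assume "k < length (map ((!) u) is)"
      then have k: "k < n" by (simp add: n_def)
      have "w ! (m + k) = w ! (is ! k)"
        using w k by (auto simp: G_def E_def)
      then show "map ((!) u) is ! k = x ! k"
        using k lt[OF k] len by (simp add: wux nth_append n_def)
    qed (simp add: len n_def)
    then show "v \<in> {w \<in> Rn m. map ((!) w) is \<in> X}"
      using u x len by (simp add: v wux)
  next
    fix v assume "v \<in> {w \<in> Rn m. map ((!) w) is \<in> X}"
    then have v: "v \<in> Rn m" and x: "map ((!) v) is \<in> X" by auto
    have len: "length v = m" using v by (simp add: Rn_def)
    have "v @ map ((!) v) is \<in> G"
      using v x len lt by (auto simp: G_def E_def set_append_def Rn_def n_def nth_append)
    then show "v \<in> take m ` G"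
      using len by (force simp: image_iff)
  qed
  ultimately show ?thesis
    using o_minimal_take[OF D m] by metis
qed

section \<open>Definable maps compose\<close>

lemma map_nth_slice:
  assumes "length u = i"
  shows "map ((!) (u @ v @ w)) [i..<i + length v] = v"
  by (rule nth_equalityI) (use assms in \<open>auto simp: nth_append\<close>)

lemma definable_map_compose:
  assumes D: "o_minimal D"
    and A: "definable D A" and B: "definable D B" and C: "definable D C"
    and f: "definable_map D A B f" and g: "definable_map D B C g"
  shows "definable_map D A C (compose (pts A) g f)"
proof -
  define a b c where "a = arity A" and "b = arity B" and "c = arity C"
  define Gf where "Gf = {x @ f x | x. x \<in> pts A}"
  define Gg where "Gg = {y @ g y | y. y \<in> pts B}"
  have pos: "a \<ge> 1" "b \<ge> 1" "c \<ge> 1"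
    using A B C by (auto simp: definable_def a_def b_def c_def)
  have AR: "pts A \<subseteq> Rn a" and BR: "pts B \<subseteq> Rn b" and CR: "pts C \<subseteq> Rn c"
    using A B C o_minimal_subset[OF D] by (simp_all add: definable_def a_def b_def c_def)
  have fB: "f x \<in> pts B" if "x \<in> pts A" for x
    using f that by (auto simp: definable_map_def)
  have gC: "g y \<in> pts C" if "y \<in> pts B" for y
    using g that by (auto simp: definable_map_def)
  \<comment> \<open>The coordinates are ordered as \<open>(x, z, y)\<close>, so that projecting away the last ones forgets \<open>y\<close>.\<close>
  define xs zs ys where "xs = [0..<a]" and "zs = [a..<a + c]" and "ys = [a + c..<a + c + b]"
  define W where "W = {w \<in> Rn (a + c + b). map ((!) w) (xs @ ys) \<in> Gf}
                    \<inter> {w \<in> Rn (a + c + b). map ((!) w) (ys @ zs) \<in> Gg}"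
  have coords: "map ((!) (x @ z @ y)) xs = x" "map ((!) (x @ z @ y)) zs = z"
      "map ((!) (x @ z @ y)) ys = y"
    if "length x = a" "length z = c" "length y = b" for x y z :: "real list"
    using map_nth_slice[of "[]" 0 x "z @ y"] map_nth_slice[of x a z y]
      map_nth_slice[of "x @ z" "a + c" y "[]"] that
    by (simp_all add: xs_def ys_def zs_def)
  have "W \<in> D (a + c + b)"
    unfolding W_def
  proof (intro o_minimal_Int D o_minimal_coordinate_preimage)
    show "Gf \<in> D (length (xs @ ys))"
      using f by (simp add: definable_map_def Gf_def xs_def ys_def a_def b_def)
    show "Gg \<in> D (length (ys @ zs))"
      using g by (simp add: definable_map_def Gg_def ys_def zs_def b_def c_def)
  qed (use pos in \<open>auto simp: xs_def ys_def zs_def\<close>)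
  then have "take (a + c) ` W \<in> D (a + c)"
    using pos by (intro o_minimal_take D) auto
  moreover have "take (a + c) ` W = {x @ compose (pts A) g f x | x. x \<in> pts A}"
  proof (intro equalityI subsetI)
    fix v assume "v \<in> take (a + c) ` W"
    then obtain w where w: "w \<in> W" and v: "v = take (a + c) w" by blast
    define x z y where "x = take a w" and "z = take c (drop a w)" and "y = drop (a + c) w"
    have lw: "length w = a + c + b" using w by (simp add: W_def Rn_def)
    then have len: "length x = a" "length z = c" "length y = b"
      by (simp_all add: x_def z_def y_def)
    have wxzy: "w = x @ z @ y"
      unfolding x_def z_def y_def by (metis add.commute append_take_drop_id drop_drop)
    have "x @ y \<in> Gf" "y @ z \<in> Gg"
      using w coords[OF len] by (simp_all add: W_def wxzy)
    then obtain x' y' where x': "x' \<in> pts A" "x @ y = x' @ f x'"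
      and y': "y' \<in> pts B" "y @ z = y' @ g y'"
      unfolding Gf_def Gg_def by blast
    have "length x' = a" "length y' = b"
      using x' y' AR BR by (auto simp: Rn_def)
    with x' y' len have "x \<in> pts A" "y = f x" "z = g y" by auto
    then show "v \<in> {x @ compose (pts A) g f x | x. x \<in> pts A}"
      using len by (auto simp: v wxzy compose_def)
  next
    fix v assume "v \<in> {x @ compose (pts A) g f x | x. x \<in> pts A}"
    then obtain x where x: "x \<in> pts A" and v: "v = x @ g (f x)"
      by (auto simp: compose_def)
    have len: "length x = a" "length (g (f x)) = c" "length (f x) = b"
      using x fB[OF x] gC[OF fB[OF x]] AR BR CR by (auto simp: Rn_def)
    have "x @ f x \<in> Gf" "f x @ g (f x) \<in> Gg"
      using x fB by (auto simp: Gf_def Gg_def)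
    then have "x @ g (f x) @ f x \<in> W"
      using coords[OF len] len by (simp add: W_def Rn_def)
    then have "take (a + c) (x @ g (f x) @ f x) \<in> take (a + c) ` W"
      by (rule imageI)
    then show "v \<in> take (a + c) ` W"
      using len by (simp add: v)
  qed
  moreover have "compose (pts A) g f \<in> pts A \<rightarrow>\<^sub>E pts C"
    using fB gC by (auto simp: compose_def)
  ultimately show ?thesis
    by (simp add: definable_map_def a_def c_def)
qed

section \<open>Restriction of sections\<close>

lemma is_morphism_mor_comp:
  assumes D: "o_minimal D" and S: "is_system D S" and T: "is_system D T" and R: "is_system D R"
    and f: "is_morphism D S T f" and g: "is_morphism D T R g"
  shows "is_morphism D S R (mor_comp S g f)"
proof -
  have maps: "definable_map D (bef S) (bef R) (mb (mor_comp S g f))"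
    "definable_map D (aft S) (aft R) (ma (mor_comp S g f))"
    "definable_map D (inp S) (inp R) (mi (mor_comp S g f))"
    "definable_map D (outp S) (outp R) (mo (mor_comp S g f))"
    unfolding mor_comp_def morphism.simps
    using S T R f g unfolding is_system_def is_morphism_def
    by (blast intro: definable_map_compose[OF D])+
  have "map_prod (ma (mor_comp S g f)) (mo (mor_comp S g f)) (step S (s, i))
      = step R (mb (mor_comp S g f) s, mi (mor_comp S g f) i)"
    if s: "s \<in> pts (bef S)" and i: "i \<in> pts (inp S)" for s i
  proof -
    obtain t out where st: "step S (s, i) = (t, out)" by fastforce
    have "step S (s, i) \<in> pts (aft S) \<times> pts (outp S)"
      using S s i by (auto simp: is_system_def)
    then have t: "t \<in> pts (aft S)" "out \<in> pts (outp S)"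
      by (simp_all add: st)
    have "mb f s \<in> pts (bef T)" "mi f i \<in> pts (inp T)"
      using f s i by (auto simp: is_morphism_def definable_map_def)
    then have "map_prod (ma g) (mo g) (step T (mb f s, mi f i)) = step R (mb g (mb f s), mi g (mi f i))"
      using g by (auto simp: is_morphism_def)
    moreover have "step T (mb f s, mi f i) = (ma f t, mo f out)"
      using f s i st unfolding is_morphism_def by (metis map_prod_simp)
    ultimately show ?thesis
      using s i t by (simp add: st mor_comp_def compose_def)
  qed
  with maps show ?thesis
    unfolding is_morphism_def by blast
qed

text \<open>The interface maps of a section over \<open>U\<close> are those of the judge restricted along \<open>m\<close>, so after
  restriction along \<open>n\<close> they are those of the judge restricted along \<open>m \<circ> n\<close>, by associativity.\<close>

lemma sec_restrict_in_sections:
  assumes D: "o_minimal D" and U: "is_system D U" and V: "is_system D V"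
    and n: "is_morphism D V U n" and p: "p \<in> sections D j U m"
  shows "sec_restrict V n p \<in> sections D j V (mor_comp V m n)"
proof -
  obtain T \<psi> where p_eq: "p = (T, \<psi>)" by fastforce
  have T: "is_system D T" "homogeneous T" "inp T = jin j" "outp T = jout j"
    and \<psi>: "is_morphism D U T \<psi>"
    and interface: "mi \<psi> = compose (pts (inp U)) (jI j) (mi m)"
      "mo \<psi> = compose (pts (outp U)) (jO j) (mo m)"
    using p by (auto simp: p_eq sections_def)
  have "mi n i \<in> pts (inp U)" if "i \<in> pts (inp V)" for i
    using n that by (auto simp: is_morphism_def definable_map_def)
  moreover have "mo n i \<in> pts (outp U)" if "i \<in> pts (outp V)" for i
    using n that by (auto simp: is_morphism_def definable_map_def)
  ultimately have
    "mi (mor_comp V \<psi> n) = compose (pts (inp V)) (jI j) (mi (mor_comp V m n))"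
    "mo (mor_comp V \<psi> n) = compose (pts (outp V)) (jO j) (mo (mor_comp V m n))"
    by (auto simp: mor_comp_def interface compose_def fun_eq_iff)
  then show ?thesis
    using T is_morphism_mor_comp[OF D V U T(1) n \<psi>]
    by (simp add: p_eq sec_restrict_def sections_def)
qed

section \<open>Separation\<close>

lemma covering_morphism:
  assumes "covering D U K V c" "k \<in> K"
  shows "is_system D (V k)" "is_morphism D (V k) U (c k)"
  using assms by (auto simp: covering_def sys_open_immersion_def)

text \<open>A covering is jointly surjective on pairs of a before-state and an input, so an input is needed
  to pass to before-states alone; without inputs, no before-state would have to be reached.\<close>

lemma covering_before_state:
  assumes cov: "covering D U K V c" and U: "is_system D U" and x: "x \<in> pts (bef U)"
  obtains k y where "k \<in> K" "y \<in> pts (bef (V k))" "x = mb (c k) y"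
proof -
  obtain i where "i \<in> pts (inp U)"
    using U by (auto simp: is_system_def)
  with x have "(x, i) \<in> (\<Union>k\<in>K. map_prod (mb (c k)) (mi (c k)) ` (pts (bef (V k)) \<times> pts (inp (V k))))"
    using cov by (simp add: covering_def)
  then show thesis
    using that by auto
qed

lemma beh_equiv_if_locally:
  assumes cov: "covering D U K V c" and U: "is_system D U"
    and p: "p \<in> sections D j U m" and q: "q \<in> sections D j U m"
    and loc: "\<And>k. k \<in> K \<Longrightarrow>
      (sec_restrict (V k) (c k) p, sec_restrict (V k) (c k) q) \<in> beh_equiv D j (V k) (mor_comp (V k) m (c k))"
  shows "(p, q) \<in> beh_equiv D j U m"
proof -
  obtain T1 \<psi>1 T2 \<psi>2 where pq: "p = (T1, \<psi>1)" "q = (T2, \<psi>2)" by fastforce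
  have "run T1 (mb \<psi>1 x) is = run T2 (mb \<psi>2 x) is"
    if x: "x \<in> pts (bef U)" and "is": "is \<in> lists (pts (jin j))" for x "is"
  proof -
    obtain k y where k: "k \<in> K" and y: "y \<in> pts (bef (V k))" and xy: "x = mb (c k) y"
      using covering_before_state[OF cov U x] .
    have "run T1 (mb (mor_comp (V k) \<psi>1 (c k)) y) is = run T2 (mb (mor_comp (V k) \<psi>2 (c k)) y) is"
      using loc[OF k] y "is" by (simp add: pq beh_equiv_def sec_restrict_def)
    then show ?thesis
      using y by (simp add: mor_comp_def compose_def xy)
  qed
  then show ?thesis
    using p q by (simp add: pq beh_equiv_def)
qed

lemma sec_restrict_beh_equiv:
  assumes D: "o_minimal D" and U: "is_system D U" and V: "is_system D V"
    and n: "is_morphism D V U n" and pq: "(p, q) \<in> beh_equiv D j U m"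
  shows "(sec_restrict V n p, sec_restrict V n q) \<in> beh_equiv D j V (mor_comp V m n)"
proof -
  obtain T1 \<psi>1 T2 \<psi>2 where eqs: "p = (T1, \<psi>1)" "q = (T2, \<psi>2)" by fastforce
  have sec: "p \<in> sections D j U m" "q \<in> sections D j U m"
    and runs: "\<And>x is. x \<in> pts (bef U) \<Longrightarrow> is \<in> lists (pts (jin j)) \<Longrightarrow>
      run T1 (mb \<psi>1 x) is = run T2 (mb \<psi>2 x) is"
    using pq by (auto simp: eqs beh_equiv_def)
  have "mb n y \<in> pts (bef U)" if "y \<in> pts (bef V)" for y
    using n that by (auto simp: is_morphism_def definable_map_def)
  then show ?thesis
    using sec[THEN sec_restrict_in_sections[OF D U V n]] runs
    by (auto simp: eqs beh_equiv_def sec_restrict_def mor_comp_def compose_def)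
qed

text \<open>The restriction of a class is by definition a union of classes, one for each representative;
  they coincide because restriction preserves equivalence.\<close>

lemma beh_restrict_class:
  assumes D: "o_minimal D" and U: "is_system D U" and V: "is_system D V"
    and n: "is_morphism D V U n" and p: "p \<in> sections D j U m"
  shows "beh_restrict D j m V n (beh_equiv D j U m `` {p})
    = beh_equiv D j V (mor_comp V m n) `` {sec_restrict V n p}"
proof -
  have "(p, p) \<in> beh_equiv D j U m"
    using p equiv_class_self[OF equiv_beh_equiv] by blast
  moreover have "beh_equiv D j V (mor_comp V m n) `` {sec_restrict V n q}
      = beh_equiv D j V (mor_comp V m n) `` {sec_restrict V n p}"
    if "(p, q) \<in> beh_equiv D j U m" for q
    using equiv_class_eq[OF equiv_beh_equiv sec_restrict_beh_equiv[OF D U V n that]] by simp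
  ultimately show ?thesis
    unfolding beh_restrict_def by blast
qed

theorem theorem4p1:
  fixes D :: "nat \<Rightarrow> real list set set"
    and S U :: system and j :: judge and m :: morphism
    and K :: "'k set" and V :: "'k \<Rightarrow> system" and c :: "'k \<Rightarrow> morphism"
    and C1 C2 :: "(system \<times> morphism) set"
  assumes "o_minimal D"
    and "is_system D S"
    and "is_judge D S j"
    and "is_system D U" and "sys_open_immersion D U S m"
    and "covering D U K V c"
    and "C1 \<in> beh_presheaf D j U m" and "C2 \<in> beh_presheaf D j U m"
    and "\<And>k. k \<in> K \<Longrightarrow> beh_restrict D j m (V k) (c k) C1 = beh_restrict D j m (V k) (c k) C2"
  shows "C1 = C2"
proof -
  obtain p q where p: "p \<in> sections D j U m" "C1 = beh_equiv D j U m `` {p}"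
    and q: "q \<in> sections D j U m" "C2 = beh_equiv D j U m `` {q}"
    using assms(7,8) unfolding beh_presheaf_def by (auto elim!: quotientE)
  have "(p, q) \<in> beh_equiv D j U m"
  proof (rule beh_equiv_if_locally[OF assms(6,4) p(1) q(1)])
    fix k assume k: "k \<in> K"
    note Vk = assms(1,4) covering_morphism[OF assms(6) k]
    have "beh_equiv D j (V k) (mor_comp (V k) m (c k)) `` {sec_restrict (V k) (c k) p}
        = beh_equiv D j (V k) (mor_comp (V k) m (c k)) `` {sec_restrict (V k) (c k) q}"
      using assms(9)[OF k] beh_restrict_class[OF Vk p(1)] beh_restrict_class[OF Vk q(1)]
      by (simp add: p(2) q(2))
    then show "(sec_restrict (V k) (c k) p, sec_restrict (V k) (c k) q)
        \<in> beh_equiv D j (V k) (mor_comp (V k) m (c k))"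
      using eq_equiv_class[OF _ equiv_beh_equiv] sec_restrict_in_sections[OF Vk q(1)] by blast
  qed
  then show ?thesis
    unfolding p(2) q(2) by (rule equiv_class_eq[OF equiv_beh_equiv])
qed

end
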